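(* For an arbitrary field $F$ of characteristic zero, the superalgebra $$GCK(A,\Delta)=A+w_1A+w_2A+w_3A+\overline{M}+x_1\overline{M}+x_2\overline{M}+x_3\overline{M}$$ (a subsuperalgebra of the Cheng--Kac superalgebra $CK(\Gamma,D)$, where $\Gamma=F[x,y]/(x^2+y^4-1)F[x,y]$, $D$ is the derivation of $\Gamma$ induced by $2y^3\frac{\partial}{\partial x}-x\frac{\partial}{\partial y}$, $A$ is the subalgebra of $\Gamma$ generated by $1,y^2,xy$, and $M=xA+yA$) is a simple unital Jordan superalgebra.
   Context: A superalgebra over $F$ is a $\mathbb{Z}_2$-graded (not necessarily associative) $F$-algebra $J=J_0+J_1$, with $J_iJ_j\subseteq J_{i+j\bmod 2}$; for homogeneous $a$, $p(a)\in\{0,1\}$ denotes its parity. It is simple if it has nonzero multiplication and no proper nonzero $\mathbb{Z}_2$-graded ideals. Let $R_x$ be the operator of right multiplication by $x$ (operators written on the right). $J$ is a Jordan superalgebra if its homogeneous elements satisfy $$aR_b=(-1)^{p(a)p(b)}bR_a,\qquad R_{a^2}R_a=R_aR_{a^2},$$ $$R_aR_bR_c+(-1)^{p(a)p(b)+p(a)p(c)+p(b)p(c)}R_cR_bR_a+(-1)^{p(b)p(c)}R_{(ac)b}=R_aR_{bc}+(-1)^{p(a)p(b)}R_bR_{ac}+(-1)^{p(a)p(c)+p(b)p(c)}R_cR_{ab}.$$ The Cheng--Kac superalgebra $CK(\Gamma,D)$: let $\Gamma$ be an associative commutative $F$-algebra with a nonzero derivation $D$. Let $J_0=\Gamma+w_1\Gamma+w_2\Gamma+w_3\Gamma$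 and $J_1=\overline{\Gamma}+x_1\overline{\Gamma}+x_2\overline{\Gamma}+x_3\overline{\Gamma}$ be direct sums of linear spaces, where $\overline{\Gamma}$ is an isomorphic copy of the linear space $\Gamma$ via $a\mapsto\overline{a}$ (here $w_1,w_2,w_3,x_1,x_2,x_3$ are formal symbols). For $a,b\in\Gamma$ define a commutative multiplication on $J_0$ by $$a\cdot b=ab,\quad a\cdot w_ib=w_i(ab),\quad w_1a\cdot w_1b=w_2a\cdot w_2b=ab,\quad w_3a\cdot w_3b=-ab,\quad w_ia\cdot w_jb=0\ (i\neq j).$$ Put $x_{i\times i}=0$, $x_{1\times2}=-x_{2\times1}=x_3$, $x_{1\times3}=-x_{3\times1}=x_2$, $x_{2\times3}=-x_{3\times2}=-x_1$. The action $J_0\times J_1\to J_1$ is $$a\cdot\overline{b}=\overline{ab},\quad a\cdot x_i\overline{b}=x_i\overline{ab},\quad w_ia\cdot\overline{b}=x_i\overline{D(a)b},\quad w_ia\cdot x_j\overline{b}=x_{i\times j}\overline{ab},$$ and $u\cdot v=v\cdot u$ for $u\in J_1$, $v\in J_0$. The bracket on $J_1$ is $$\overline{a}\cdot\overline{b}=D(a)b-aD(b),\quad \overline{a}\cdot x_i\overline{b}=-w_i(ab),\quad x_i\overline{a}\cdot\overline{b}=w_i(ab),\quad x_i\overline{a}\cdot x_j\overline{b}=0.$$ $CK(\Gamma,D)=J_0+J_1$ with the resulting bilinear multiplication. In the present setting: $x,y\in\Gamma$ denote the images of the variables, $\overline{M}=\{\overline{m}:m\in M\}$, and $GCK(A,\Delta)$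 is the indicated subspace of $CK(\Gamma,D)$ with the multiplication of $CK(\Gamma,D)$; its even part is $A+w_1A+w_2A+w_3A$ and its odd part is $\overline{M}+x_1\overline{M}+x_2\overline{M}+x_3\overline{M}$. (The letter $\Delta$ in the notation stands for the set of derivations $\{(1-y^4)D,\ xyD,\ y^2D\}$ of $A$.) *)

theory Defs
  imports
    "HOL-Computational_Algebra.Polynomial"
    "HOL-Library.Product_Plus"
    "HOL-Library.Set_Algebras"
begin

section \<open>Superalgebras\<close>

text \<open>
  A superalgebra is given inside an ambient vector space by its even part \<open>J0\<close> and its odd part
  \<open>J1\<close>; its carrier is the direct sum \<open>J0 + J1\<close>. The product need only be
  bilinear on the carrier. Parities are natural numbers read modulo 2.
\<close>

locale superalgebra = vector_space scale
  for scale :: "'f::field \<Rightarrow> 'v::ab_group_add \<Rightarrow> 'v" +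
  fixes mul :: "'v \<Rightarrow> 'v \<Rightarrow> 'v"  (infixl "\<cdot>" 70)
    and J0 J1 :: "'v set"
  assumes subspace_even: "subspace J0"
    and subspace_odd: "subspace J1"
    and direct: "J0 \<inter> J1 = {0}"
    and mult_add_left: "\<lbrakk>u \<in> J0 + J1; v \<in> J0 + J1; z \<in> J0 + J1\<rbrakk> \<Longrightarrow> (u + v) \<cdot> z = u \<cdot> z + v \<cdot> z"
    and mult_add_right: "\<lbrakk>u \<in> J0 + J1; v \<in> J0 + J1; z \<in> J0 + J1\<rbrakk> \<Longrightarrow> z \<cdot> (u + v) = z \<cdot> u + z \<cdot> v"
    and mult_scale_left: "\<lbrakk>u \<in> J0 + J1; v \<in> J0 + J1\<rbrakk> \<Longrightarrow> scale c u \<cdot> v = scale c (u \<cdot> v)"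
    and mult_scale_right: "\<lbrakk>u \<in> J0 + J1; v \<in> J0 + J1\<rbrakk> \<Longrightarrow> u \<cdot> scale c v = scale c (u \<cdot> v)"
    and even_even: "\<lbrakk>u \<in> J0; v \<in> J0\<rbrakk> \<Longrightarrow> u \<cdot> v \<in> J0"
    and even_odd: "\<lbrakk>u \<in> J0; v \<in> J1\<rbrakk> \<Longrightarrow> u \<cdot> v \<in> J1"
    and odd_even: "\<lbrakk>u \<in> J1; v \<in> J0\<rbrakk> \<Longrightarrow> u \<cdot> v \<in> J1"
    and odd_odd: "\<lbrakk>u \<in> J1; v \<in> J1\<rbrakk> \<Longrightarrow> u \<cdot> v \<in> J0"
begin

definition hom_part :: "nat \<Rightarrow> 'v set" where
  "hom_part i = (if even i then J0 else J1)"

definition graded_ideal :: "'v set \<Rightarrow> bool" where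
  "graded_ideal I \<longleftrightarrow>
     subspace I \<and> I \<subseteq> J0 + J1 \<and> I = (I \<inter> J0) + (I \<inter> J1) \<and>
     (\<forall>u\<in>I. \<forall>v\<in>J0 + J1. u \<cdot> v \<in> I \<and> v \<cdot> u \<in> I)"

end

locale unital_superalgebra = superalgebra +
  assumes unit: "\<exists>e\<in>J0 + J1. \<forall>u\<in>J0 + J1. e \<cdot> u = u \<and> u \<cdot> e = u"

locale simple_superalgebra = superalgebra +
  assumes nonzero_mult: "\<exists>u\<in>J0 + J1. \<exists>v\<in>J0 + J1. u \<cdot> v \<noteq> 0"
    and no_proper_ideal: "graded_ideal I \<Longrightarrow> I = {0} \<or> I = J0 + J1"

text \<open>
  The defining identities are identities between right multiplication operators written on the
  right, so \<open>z\<close> is an arbitrary element of the carrier and \<open>R\<^sub>a R\<^sub>b\<close> sends it to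
  \<open>(z \<cdot> a) \<cdot> b\<close>.
\<close>

locale jordan_superalgebra = superalgebra +
  assumes supercommutative:
      "\<lbrakk>a \<in> hom_part i; b \<in> hom_part j\<rbrakk> \<Longrightarrow> a \<cdot> b = scale ((-1) ^ (i * j)) (b \<cdot> a)"
    and jordan_square:
      "\<lbrakk>a \<in> hom_part i; z \<in> J0 + J1\<rbrakk> \<Longrightarrow> (z \<cdot> (a \<cdot> a)) \<cdot> a = (z \<cdot> a) \<cdot> (a \<cdot> a)"
    and jordan_linearized:
      "\<lbrakk>a \<in> hom_part i; b \<in> hom_part j; c \<in> hom_part k; z \<in> J0 + J1\<rbrakk> \<Longrightarrow>
         ((z \<cdot> a) \<cdot> b) \<cdot> c
           + scale ((-1) ^ (i * j + i * k + j * k)) (((z \<cdot> c) \<cdot> b) \<cdot> a)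
           + scale ((-1) ^ (j * k)) (z \<cdot> ((a \<cdot> c) \<cdot> b))
         = (z \<cdot> a) \<cdot> (b \<cdot> c)
           + scale ((-1) ^ (i * j)) ((z \<cdot> b) \<cdot> (a \<cdot> c))
           + scale ((-1) ^ (i * k + j * k)) ((z \<cdot> c) \<cdot> (a \<cdot> b))"

definition subsuperalgebra ::
  "('f::field \<Rightarrow> 'v::ab_group_add \<Rightarrow> 'v) \<Rightarrow> ('v \<Rightarrow> 'v \<Rightarrow> 'v) \<Rightarrow> 'v set \<Rightarrow> 'v set \<Rightarrow> 'v set \<Rightarrow> 'v set \<Rightarrow> bool"
  where
  "subsuperalgebra scale mul J0 J1 K0 K1 \<longleftrightarrow>
     superalgebra scale mul J0 J1 \<and> superalgebra scale mul K0 K1 \<and> J0 \<subseteq> K0 \<and> J1 \<subseteq> K1"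


section \<open>Subalgebras and derivations of a commutative algebra\<close>

definition subalgebra :: "('f::field \<Rightarrow> 'g::comm_ring_1 \<Rightarrow> 'g) \<Rightarrow> 'g set \<Rightarrow> bool" where
  "subalgebra scale S \<longleftrightarrow> module.subspace scale S \<and> (\<forall>a\<in>S. \<forall>b\<in>S. a * b \<in> S)"

definition derivation :: "('f::field \<Rightarrow> 'g::comm_ring_1 \<Rightarrow> 'g) \<Rightarrow> ('g \<Rightarrow> 'g) \<Rightarrow> bool" where
  "derivation scale D \<longleftrightarrow>
     Vector_Spaces.linear scale scale D \<and> (\<forall>a b. D (a * b) = D a * b + a * D b)"


section \<open>Cheng--Kac superalgebras\<close>

text \<open>
  The tuple \<open>((a0, a1, a2, a3), (b0, b1, b2, b3))\<close> stands for
  \<open>a0 + w\<^sub>1 a1 + w\<^sub>2 a2 + w\<^sub>3 a3 + bar b0 + x\<^sub>1 (bar b1) + x\<^sub>2 (bar b2) + x\<^sub>3 (bar b3)\<close>.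
  The multiplication table on the eight kinds of generators is recovered below.
\<close>

type_synonym 'g ck = "('g \<times> 'g \<times> 'g \<times> 'g) \<times> ('g \<times> 'g \<times> 'g \<times> 'g)"

definition ck_scale :: "('f \<Rightarrow> 'g \<Rightarrow> 'g) \<Rightarrow> 'f \<Rightarrow> 'g ck \<Rightarrow> 'g ck" where
  "ck_scale s c = (\<lambda>((a0, a1, a2, a3), (b0, b1, b2, b3)).
     ((s c a0, s c a1, s c a2, s c a3), (s c b0, s c b1, s c b2, s c b3)))"

fun ck_even_mult :: "'g::comm_ring_1 \<times> 'g \<times> 'g \<times> 'g \<Rightarrow> 'g \<times> 'g \<times> 'g \<times> 'g \<Rightarrow> 'g \<times> 'g \<times> 'g \<times> 'g" where
  "ck_even_mult (a0, a1, a2, a3) (c0, c1, c2, c3) =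
     (a0 * c0 + a1 * c1 + a2 * c2 - a3 * c3, a0 * c1 + a1 * c0, a0 * c2 + a2 * c0, a0 * c3 + a3 * c0)"

text \<open>The action \<open>J\<^sub>0 \<times> J\<^sub>1 \<rightarrow> J\<^sub>1\<close>; the products with two opposite signs come from \<open>x\<^bsub>i\<times>j\<^esub>\<close>.\<close>

fun ck_act ::
  "('g::comm_ring_1 \<Rightarrow> 'g) \<Rightarrow> 'g \<times> 'g \<times> 'g \<times> 'g \<Rightarrow> 'g \<times> 'g \<times> 'g \<times> 'g \<Rightarrow> 'g \<times> 'g \<times> 'g \<times> 'g" where
  "ck_act D (a0, a1, a2, a3) (d0, d1, d2, d3) =
     (a0 * d0,
      a0 * d1 + D a1 * d0 + (a3 * d2 - a2 * d3),
      a0 * d2 + D a2 * d0 + (a1 * d3 - a3 * d1),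
      a0 * d3 + D a3 * d0 + (a1 * d2 - a2 * d1))"

text \<open>The bracket \<open>J\<^sub>1 \<times> J\<^sub>1 \<rightarrow> J\<^sub>0\<close>.\<close>

fun ck_bracket ::
  "('g::comm_ring_1 \<Rightarrow> 'g) \<Rightarrow> 'g \<times> 'g \<times> 'g \<times> 'g \<Rightarrow> 'g \<times> 'g \<times> 'g \<times> 'g \<Rightarrow> 'g \<times> 'g \<times> 'g \<times> 'g" where
  "ck_bracket D (b0, b1, b2, b3) (d0, d1, d2, d3) =
     (D b0 * d0 - b0 * D d0, b1 * d0 - b0 * d1, b2 * d0 - b0 * d2, b3 * d0 - b0 * d3)"

definition ck_mult :: "('g::comm_ring_1 \<Rightarrow> 'g) \<Rightarrow> 'g ck \<Rightarrow> 'g ck \<Rightarrow> 'g ck" where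
  "ck_mult D u v =
     (ck_even_mult (fst u) (fst v) + ck_bracket D (snd u) (snd v),
      ck_act D (fst u) (snd v) + ck_act D (fst v) (snd u))"

text \<open>
  For subsets \<open>A\<close> and \<open>M\<close> of the base algebra, \<open>ck_even A\<close> is \<open>A + w\<^sub>1 A + w\<^sub>2 A + w\<^sub>3 A\<close> and
  \<open>ck_odd M\<close> is \<open>bar M + x\<^sub>1 (bar M) + x\<^sub>2 (bar M) + x\<^sub>3 (bar M)\<close>; the full Cheng--Kac superalgebra
  is the case \<open>A = M = UNIV\<close>.
\<close>

definition ck_even :: "'g::comm_ring_1 set \<Rightarrow> 'g ck set" where
  "ck_even A = (A \<times> A \<times> A \<times> A) \<times> {0}"

definition ck_odd :: "'g::comm_ring_1 set \<Rightarrow> 'g ck set" where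
  "ck_odd M = {0} \<times> (M \<times> M \<times> M \<times> M)"

definition ck_base :: "'g::comm_ring_1 \<Rightarrow> 'g ck" where
  "ck_base a = ((a, 0, 0, 0), 0)"

definition ck_w :: "nat \<Rightarrow> 'g::comm_ring_1 \<Rightarrow> 'g ck" where
  "ck_w i a = ((0, if i = 1 then a else 0, if i = 2 then a else 0, if i = 3 then a else 0), 0)"

definition ck_bar :: "'g::comm_ring_1 \<Rightarrow> 'g ck" where
  "ck_bar a = (0, (a, 0, 0, 0))"

definition ck_x :: "nat \<Rightarrow> 'g::comm_ring_1 \<Rightarrow> 'g ck" where
  "ck_x i a = (0, (0, if i = 1 then a else 0, if i = 2 then a else 0, if i = 3 then a else 0))"

lemmas ck_generator_defs = ck_base_def ck_w_def ck_bar_def ck_x_def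

lemma ck_decompose:
  "((a0, a1, a2, a3), (b0, b1, b2, b3)) =
     ck_base a0 + ck_w 1 a1 + ck_w 2 a2 + ck_w 3 a3
       + ck_bar b0 + ck_x 1 b1 + ck_x 2 b2 + ck_x 3 b3"
  by (simp add: ck_generator_defs zero_prod_def)

lemma ck_table_even_even:
  assumes "i \<in> {1,2,3}" "j \<in> {1,2,3}" "D 0 = 0"
  shows "ck_mult D (ck_base a) (ck_base b) = ck_base (a * b)"
    and "ck_mult D (ck_base a) (ck_w i b) = ck_w i (a * b)"
    and "ck_mult D (ck_w i b) (ck_base a) = ck_w i (a * b)"
    and "ck_mult D (ck_w 1 a) (ck_w 1 b) = ck_base (a * b)"
    and "ck_mult D (ck_w 2 a) (ck_w 2 b) = ck_base (a * b)"
    and "ck_mult D (ck_w 3 a) (ck_w 3 b) = ck_base (- (a * b))"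
    and "i \<noteq> j \<Longrightarrow> ck_mult D (ck_w i a) (ck_w j b) = 0"
  using assms by (auto simp: ck_mult_def ck_generator_defs zero_prod_def mult.commute)

lemma ck_table_even_odd:
  assumes "i \<in> {1,2,3}" "D 0 = 0"
  shows "ck_mult D (ck_base a) (ck_bar b) = ck_bar (a * b)"
    and "ck_mult D (ck_base a) (ck_x i b) = ck_x i (a * b)"
    and "ck_mult D (ck_w i a) (ck_bar b) = ck_x i (D a * b)"
    and "ck_mult D (ck_w i a) (ck_x i b) = 0"
    and "ck_mult D (ck_w 1 a) (ck_x 2 b) = ck_x 3 (a * b)"
    and "ck_mult D (ck_w 2 a) (ck_x 1 b) = - ck_x 3 (a * b)"
    and "ck_mult D (ck_w 1 a) (ck_x 3 b) = ck_x 2 (a * b)"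
    and "ck_mult D (ck_w 3 a) (ck_x 1 b) = - ck_x 2 (a * b)"
    and "ck_mult D (ck_w 2 a) (ck_x 3 b) = - ck_x 1 (a * b)"
    and "ck_mult D (ck_w 3 a) (ck_x 2 b) = ck_x 1 (a * b)"
  using assms by (auto simp: ck_mult_def ck_generator_defs zero_prod_def)

lemma ck_table_odd_even:
  assumes "D 0 = 0" "u \<in> ck_odd UNIV" "v \<in> ck_even UNIV"
  shows "ck_mult D u v = ck_mult D v u"
  using assms by (cases u; cases v) (auto simp: ck_mult_def ck_even_def ck_odd_def zero_prod_def)

lemma ck_table_odd_odd:
  assumes "i \<in> {1,2,3}" "j \<in> {1,2,3}" "D 0 = 0"
  shows "ck_mult D (ck_bar a) (ck_bar b) = ck_base (D a * b - a * D b)"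
    and "ck_mult D (ck_bar a) (ck_x i b) = - ck_w i (a * b)"
    and "ck_mult D (ck_x i a) (ck_bar b) = ck_w i (a * b)"
    and "ck_mult D (ck_x i a) (ck_x j b) = 0"
  using assms by (auto simp: ck_mult_def ck_generator_defs zero_prod_def)


section \<open>The ring of the curve \<open>x\<^sup>2 + y\<^sup>4 = 1\<close>\<close>

text \<open>
  Polynomials in \<open>x, y\<close> are polynomials in \<open>x\<close> (outer type) whose coefficients are polynomials
  in \<open>y\<close> (inner type).
\<close>

definition pX :: "'f::comm_ring_1 poly poly" where "pX = [:0, 1:]"
definition pY :: "'f::comm_ring_1 poly poly" where "pY = [:[:0, 1:]:]"

definition curve_poly :: "'f::comm_ring_1 poly poly" where
  "curve_poly = pX ^ 2 + pY ^ 4 - 1"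

definition partial_x :: "'f::idom poly poly \<Rightarrow> 'f poly poly" where
  "partial_x = pderiv"

definition partial_y :: "'f::idom poly poly \<Rightarrow> 'f poly poly" where
  "partial_y = map_poly pderiv"

definition poly_D :: "'f::idom poly poly \<Rightarrow> 'f poly poly" where
  "poly_D p = 2 * pY ^ 3 * partial_x p - pX * partial_y p"

lemma partial_y_add: "partial_y (p + q) = partial_y p + partial_y q"
  by (rule poly_eqI) (simp add: partial_y_def coeff_map_poly pderiv_add)

lemma partial_y_diff: "partial_y (p - q) = partial_y p - partial_y q"
  by (rule poly_eqI) (simp add: partial_y_def coeff_map_poly pderiv_diff)

lemma partial_y_smult: "partial_y (smult a p) = smult (pderiv a) p + smult a (partial_y p)"
  by (rule poly_eqI) (simp add: partial_y_def coeff_map_poly pderiv_mult algebra_simps)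

lemma partial_y_pCons: "partial_y (pCons a p) = pCons (pderiv a) (partial_y p)"
  by (simp add: partial_y_def map_poly_pCons)

lemma partial_y_mult: "partial_y (p * q) = partial_y p * q + p * partial_y q"
proof (induction p)
  case 0
  then show ?case by (simp add: partial_y_def)
next
  case (pCons a p)
  have "partial_y (pCons 0 (p * q)) = pCons 0 (partial_y p * q) + pCons 0 (p * partial_y q)"
    by (simp add: partial_y_pCons pCons.IH)
  then show ?case
    by (simp add: partial_y_add partial_y_smult partial_y_pCons algebra_simps)
qed

lemma poly_D_add: "poly_D (p + q) = poly_D p + poly_D q"
  by (simp add: poly_D_def partial_x_def pderiv_add partial_y_add algebra_simps)

lemma poly_D_diff: "poly_D (p - q) = poly_D p - poly_D q"
  by (simp add: poly_D_def partial_x_def pderiv_diff partial_y_diff algebra_simps)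

lemma poly_D_mult: "poly_D (p * q) = poly_D p * q + p * poly_D q"
  by (simp add: poly_D_def partial_x_def pderiv_mult partial_y_mult algebra_simps)

lemma poly_D_pX: "poly_D pX = 2 * pY ^ 3"
  by (simp add: poly_D_def partial_x_def pX_def partial_y_pCons pderiv_pCons)
     (simp add: partial_y_def)

lemma poly_D_pY: "poly_D pY = (- pX :: 'f::idom poly poly)"
proof -
  have "partial_y pY = (1 :: 'f poly poly)"
    by (simp add: pY_def partial_y_pCons pderiv_pCons one_pCons) (simp add: partial_y_def)
  then show ?thesis
    by (simp add: poly_D_def partial_x_def) (simp add: pY_def pderiv_pCons)
qed

lemma poly_D_const: "poly_D [:[:c:]:] = 0"
  by (simp add: poly_D_def partial_x_def partial_y_pCons pderiv_pCons) (simp add: partial_y_def)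

lemma poly_D_curve_poly: "poly_D curve_poly = (0 :: 'f::idom poly poly)"
proof -
  have 1: "poly_D 1 = (0 :: 'f poly poly)"
    using poly_D_const[of "1 :: 'f"] by (simp add: one_pCons)
  have "poly_D (pX ^ 2) = (4 * pX * pY ^ 3 :: 'f poly poly)"
    by (simp add: power2_eq_square poly_D_mult poly_D_pX)
  moreover have "poly_D (pY ^ 4) = (- 4 * pX * pY ^ 3 :: 'f poly poly)"
    by (simp add: power4_eq_xxxx power3_eq_cube poly_D_mult poly_D_pY algebra_simps)
  ultimately show ?thesis
    by (simp add: curve_poly_def poly_D_add poly_D_diff 1)
qed

lemma curve_poly_eq: "curve_poly = [:[:-1, 0, 0, 0, 1:], 0, 1:]"
  by (simp add: curve_poly_def pX_def pY_def power2_eq_square power4_eq_xxxx one_pCons)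

lemma curve_poly_dvd_degree:
  assumes "curve_poly dvd (p :: 'f::idom poly poly)" "degree p < 2"
  shows "p = 0"
proof (rule ccontr)
  assume "p \<noteq> 0"
  then have "degree (curve_poly :: 'f poly poly) \<le> degree p"
    using assms(1) by (rule dvd_imp_degree_le[rotated])
  then show False
    using assms(2) by (simp add: curve_poly_eq)
qed

quotient_type (overloaded) 'f curve_ring =
  "'f::field poly poly" / "\<lambda>p q. curve_poly dvd p - q"
proof (rule equivpI)
  show "reflp (\<lambda>p q :: 'f poly poly. curve_poly dvd p - q)"
    by (simp add: reflp_def)
  show "symp (\<lambda>p q :: 'f poly poly. curve_poly dvd p - q)"
  proof (rule sympI)
    fix p q :: "'f poly poly"
    assume "curve_poly dvd p - q"
    then have "curve_poly dvd - (p - q)" by (simp only: dvd_minus_iff)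
    then show "curve_poly dvd q - p" by simp
  qed
  show "transp (\<lambda>p q :: 'f poly poly. curve_poly dvd p - q)"
  proof (rule transpI)
    fix p q r :: "'f poly poly"
    assume "curve_poly dvd p - q" "curve_poly dvd q - r"
    then have "curve_poly dvd (p - q) + (q - r)" by (rule dvd_add)
    then show "curve_poly dvd p - r" by simp
  qed
qed

instantiation curve_ring :: (field) comm_ring_1
begin

lift_definition zero_curve_ring :: "'a curve_ring" is "0" .
lift_definition one_curve_ring :: "'a curve_ring" is "1" .
lift_definition plus_curve_ring :: "'a curve_ring \<Rightarrow> 'a curve_ring \<Rightarrow> 'a curve_ring" is "(+)"
proof -
  fix p p' q q' :: "'a poly poly"
  assume "curve_poly dvd p - p'" "curve_poly dvd q - q'"
  then have "curve_poly dvd (p - p') + (q - q')" by (rule dvd_add)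
  then show "curve_poly dvd p + q - (p' + q')" by (simp add: algebra_simps)
qed
lift_definition minus_curve_ring :: "'a curve_ring \<Rightarrow> 'a curve_ring \<Rightarrow> 'a curve_ring" is "(-)"
proof -
  fix p p' q q' :: "'a poly poly"
  assume "curve_poly dvd p - p'" "curve_poly dvd q - q'"
  then have "curve_poly dvd (p - p') - (q - q')" by (rule dvd_diff)
  then show "curve_poly dvd p - q - (p' - q')" by (simp add: algebra_simps)
qed
lift_definition uminus_curve_ring :: "'a curve_ring \<Rightarrow> 'a curve_ring" is "uminus"
proof -
  fix p p' :: "'a poly poly"
  assume "curve_poly dvd p - p'"
  then have "curve_poly dvd - (p - p')" by (simp only: dvd_minus_iff)
  then show "curve_poly dvd - p - - p'" by simp
qed
lift_definition times_curve_ring :: "'a curve_ring \<Rightarrow> 'a curve_ring \<Rightarrow> 'a curve_ring" is "(*)"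
proof -
  fix p p' q q' :: "'a poly poly"
  assume "curve_poly dvd p - p'" "curve_poly dvd q - q'"
  then have "curve_poly dvd (p - p') * q + p' * (q - q')"
    by (intro dvd_add dvd_mult dvd_mult2)
  then show "curve_poly dvd p * q - p' * q'"
    by (simp add: algebra_simps)
qed

instance
proof
  fix a b c :: "'a curve_ring"
  show "a * b * c = a * (b * c)" by transfer (simp add: mult.assoc)
  show "a * b = b * a" by transfer (simp add: mult.commute)
  show "1 * a = a" by transfer simp
  show "a + b + c = a + (b + c)" by transfer (simp add: add.assoc)
  show "a + b = b + a" by transfer (simp add: add.commute)
  show "0 + a = a" by transfer simp
  show "- a + a = 0" by transfer simp
  show "a - b = a + - b" by transfer simp
  show "(a + b) * c = a * c + b * c" by transfer (simp add: distrib_right)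
  show "(0 :: 'a curve_ring) \<noteq> 1"
  proof transfer
    show "\<not> curve_poly dvd (0 - 1 :: 'a poly poly)"
    proof
      assume "curve_poly dvd (0 - 1 :: 'a poly poly)"
      then have "(0 - 1 :: 'a poly poly) = 0" by (rule curve_poly_dvd_degree) simp
      then show False by simp
    qed
  qed
qed

end

lift_definition curve_scale :: "'f::field \<Rightarrow> 'f curve_ring \<Rightarrow> 'f curve_ring" is
  "\<lambda>c p. [:[:c:]:] * p"
  by (simp only: dvd_mult flip: right_diff_distrib)

lift_definition cX :: "'f::field curve_ring" is pX .
lift_definition cY :: "'f::field curve_ring" is pY .

lift_definition curve_D :: "'f::field curve_ring \<Rightarrow> 'f curve_ring" is poly_D
proof -
  fix p q :: "'f poly poly"
  assume "curve_poly dvd p - q"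
  then obtain r where r: "p - q = curve_poly * r" by (elim dvdE)
  have "poly_D p - poly_D q = curve_poly * poly_D r"
    using arg_cong[OF r, of poly_D] by (simp add: poly_D_diff poly_D_mult poly_D_curve_poly)
  then show "curve_poly dvd poly_D p - poly_D q" by simp
qed

lemma curve_equation: "cX ^ 2 + cY ^ 4 = (1 :: 'f::field curve_ring)"
proof -
  have "cX * cX + cY * cY * cY * cY = (1 :: 'f curve_ring)"
    by transfer (simp add: curve_poly_def power2_eq_square power4_eq_xxxx mult.assoc)
  then show ?thesis by (simp add: power2_eq_square power4_eq_xxxx mult.assoc)
qed

lemma vector_space_curve_scale: "vector_space (curve_scale :: 'f::field \<Rightarrow> _)"
proof
  fix a b :: 'f and u v :: "'f curve_ring"
  show "curve_scale a (u + v) = curve_scale a u + curve_scale a v"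
    by transfer (simp add: algebra_simps smult_add_right)
  show "curve_scale (a + b) u = curve_scale a u + curve_scale b u"
  proof transfer
    fix a b :: 'f and u :: "'f poly poly"
    have "[:[:a + b:]:] * u = [:[:a:]:] * u + [:[:b:]:] * u"
      by (simp only: distrib_right[symmetric] add_pCons add_0_right)
    then show "curve_poly dvd [:[:a + b:]:] * u - ([:[:a:]:] * u + [:[:b:]:] * u)"
      by (simp only: diff_self dvd_0_right)
  qed
  show "curve_scale a (curve_scale b u) = curve_scale (a * b) u"
    by transfer (simp add: ac_simps)
  show "curve_scale 1 u = u"
    by transfer (simp flip: one_pCons)
qed

lemma curve_scale_mult: "curve_scale c (a * b) = curve_scale c a * b"
  by transfer (simp add: mult.assoc)

lemma curve_D_cX: "curve_D cX = 2 * cY ^ 3"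
proof -
  have "curve_D cX = cY * cY * cY + cY * cY * cY"
    by transfer (simp add: poly_D_pX power3_eq_cube mult.assoc)
  then show ?thesis by (simp only: power3_eq_cube mult.assoc mult_2)
qed

lemma curve_D_cY: "curve_D cY = - cX"
  by transfer (simp add: poly_D_pY)

lemma derivation_curve_D: "derivation curve_scale curve_D"
  unfolding derivation_def
proof (intro conjI allI)
  have "curve_D (a + b) = curve_D a + curve_D b" for a b :: "'a curve_ring"
    by transfer (simp add: poly_D_add)
  moreover have "curve_D (curve_scale c a) = curve_scale c (curve_D a)" for c and a :: "'a curve_ring"
    by transfer (simp only: poly_D_mult poly_D_const, simp)
  ultimately show "Vector_Spaces.linear curve_scale (curve_scale :: 'a \<Rightarrow> _) curve_D"
    by (simp add: Vector_Spaces.linear_iff vector_space_curve_scale)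
  show "curve_D (a * b) = curve_D a * b + a * curve_D b" for a b :: "'a curve_ring"
    by transfer (simp add: poly_D_mult)
qed

lemma curve_D_nonzero: "curve_D \<noteq> (\<lambda>_. 0 :: 'f::field curve_ring)"
proof
  assume "curve_D = (\<lambda>_. 0 :: 'f curve_ring)"
  then have "(cX :: 'f curve_ring) = 0"
    using curve_D_cY[where 'a='f] by (metis neg_equal_0_iff_equal)
  then have "curve_poly dvd (pX :: 'f poly poly)"
    by transfer simp
  then show False
    using curve_poly_dvd_degree[of "pX :: 'f poly poly"] by (simp add: pX_def)
qed


section \<open>The superalgebra \<open>GCK(A, \<Delta>)\<close>\<close>

definition curve_A :: "'f::field curve_ring set" where
  "curve_A = subalgebra curve_scale hull {1, cY ^ 2, cX * cY}"

definition curve_M :: "'f::field curve_ring set" where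
  "curve_M = (*) cX ` curve_A + (*) cY ` curve_A"

definition gck_even :: "'f::field curve_ring ck set" where
  "gck_even = ck_even curve_A"

definition gck_odd :: "'f::field curve_ring ck set" where
  "gck_odd = ck_odd curve_M"

end

theory Submission
  imports Defs
begin

text \<open>
  The superalgebra is Jordan because the whole Cheng--Kac superalgebra is: its identities are
  consequences of the Leibniz rule in a commutative ring, proved by comparing coordinates
  (\<open>ck_pair.jordan_superalgebra_ck\<close>). It is closed under the product because \<open>A\<close> and \<open>M\<close> are
  closed under the products \<open>A A \<subseteq> A\<close>, \<open>A M \<subseteq> M\<close>, \<open>M M \<subseteq> A\<close> and stable under \<open>D\<close>: they
  are the images of the polynomials with only even, respectively only odd, total degrees, a
  grading that survives because \<open>x\<^sup>2 + y\<^sup>4 - 1\<close> is even.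

  For simplicity, a nonzero graded ideal \<open>I\<close> meets \<open>A\<close> in a nonzero ideal \<open>P\<close> which is
  stable under \<open>m n D\<close> for \<open>m, n \<in> M\<close> (\<open>ck_pair.simple_superalgebra_ck\<close>). As
  \<open>D = x\<^sup>2 D + y\<^sup>2 (y\<^sup>2 D)\<close> on the curve, \<open>P\<close> is stable under \<open>D\<close> itself, and it remains to
  see that \<open>A\<close> has no proper nonzero \<open>D\<close>-stable ideal (\<open>curve_A_D_simple\<close>). Geometrically
  this holds because \<open>D\<close> is a nowhere vanishing vector field on a smooth curve in characteristic
  zero. Algebraically, \<open>A\<close> consists of the elements \<open>p(t) + w r(t)\<close> with \<open>t = y\<^sup>2\<close>, \<open>w = x y\<close> and
  \<open>w\<^sup>2 = t - t\<^sup>3\<close>, so norms put a nonzero polynomial in \<open>t\<close> into \<open>P\<close>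
  (\<open>curve_A_conjugate_product_nonzero\<close>). The polynomials in \<open>t\<close> that lie in \<open>P\<close> form an
  ideal of \<open>F[t]\<close> closed under two differential operators coming from \<open>w D\<close> and \<open>D\<^sup>2\<close>; a
  comparison of multiplicities at the roots of \<open>t\<^sup>3 - t\<close> shows that this ideal contains 1 (\<open>differential_ideal_contains_one\<close>).
\<close>

section \<open>Subsuperalgebras of Cheng--Kac superalgebras\<close>

locale ring_derivation =
  fixes D :: "'g::comm_ring_1 \<Rightarrow> 'g"
  assumes D_add: "D (a + b) = D a + D b"
    and D_mult: "D (a * b) = D a * b + a * D b"
begin

lemma D_zero [simp]: "D 0 = 0"
  using D_add[of 0 0] by simp

lemma D_one [simp]: "D 1 = 0"
  using D_mult[of 1 1] by simp

lemma D_minus: "D (- a) = - D a"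
  using D_add[of a "- a"] by (simp add: eq_neg_iff_add_eq_0 add.commute)

lemma D_diff: "D (a - b) = D a - D b"
  using D_add[of a "- b"] by (simp add: D_minus)

lemma D_two: "D 2 = 0"
  using D_add[of 1 1] by simp

lemmas D_rules = D_add D_diff D_minus D_mult D_two

end

text \<open>
  These closure conditions on \<open>A\<close> and \<open>M\<close> are what keeps
  \<open>A + w\<^sub>1 A + w\<^sub>2 A + w\<^sub>3 A\<close> plus \<open>bar M + x\<^sub>1 (bar M) + x\<^sub>2 (bar M) + x\<^sub>3 (bar M)\<close> closed under the
  Cheng--Kac product. Taking \<open>A = M = UNIV\<close> covers the whole Cheng--Kac superalgebra, so both
  it and its subsuperalgebras are instances.
\<close>

locale ck_pair = ring_derivation D + vector_space scale
  for D :: "'g::comm_ring_1 \<Rightarrow> 'g" and scale :: "'f::field \<Rightarrow> 'g \<Rightarrow> 'g" +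
  fixes A M :: "'g set"
  assumes scale_mult: "scale c (a * b) = scale c a * b"
    and D_scale: "D (scale c a) = scale c (D a)"
    and A_subspace: "subspace A"
    and M_subspace: "subspace M"
    and A_A: "a \<in> A \<Longrightarrow> a' \<in> A \<Longrightarrow> a * a' \<in> A"
    and A_M: "a \<in> A \<Longrightarrow> m \<in> M \<Longrightarrow> a * m \<in> M"
    and M_M: "m \<in> M \<Longrightarrow> m' \<in> M \<Longrightarrow> m * m' \<in> A"
    and D_A: "a \<in> A \<Longrightarrow> D a \<in> A"
    and D_M: "m \<in> M \<Longrightarrow> D m \<in> M"
begin

lemmas A_closed = subspace_0[OF A_subspace] subspace_add[OF A_subspace] subspace_diff[OF A_subspace]
  subspace_scale[OF A_subspace]

lemmas M_closed = subspace_0[OF M_subspace] subspace_add[OF M_subspace] subspace_diff[OF M_subspace]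
  subspace_scale[OF M_subspace]

lemma scale_mult_right: "a * scale c b = scale c (a * b)"
  using scale_mult[of c b a] by (simp add: mult.commute)

lemma vector_space_ck_scale: "vector_space (ck_scale scale)"
  by unfold_locales
     (auto simp: ck_scale_def scale_right_distrib scale_left_distrib)

lemma ck_carrier: "ck_even A + ck_odd M = (A \<times> A \<times> A \<times> A) \<times> (M \<times> M \<times> M \<times> M)"
  (is "?L = ?R")
proof
  show "?L \<subseteq> ?R"
    by (auto simp: ck_even_def ck_odd_def set_plus_def)
  show "?R \<subseteq> ?L"
  proof
    fix u assume "u \<in> ?R"
    then have "(fst u, 0) \<in> ck_even A" "(0, snd u) \<in> ck_odd M"
      by (auto simp: ck_even_def ck_odd_def)
    then have "(fst u, 0) + (0, snd u) \<in> ?L"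
      by (rule set_plus_intro)
    then show "u \<in> ?L" by simp
  qed
qed

lemma superalgebra_ck: "superalgebra (ck_scale scale) (ck_mult D) (ck_even A) (ck_odd M)"
proof -
  interpret ck: vector_space "ck_scale scale"
    by (rule vector_space_ck_scale)
  show ?thesis
  proof unfold_locales
    show "ck.subspace (ck_even A)" "ck.subspace (ck_odd M)"
      by (auto simp: ck.subspace_def ck_even_def ck_odd_def ck_scale_def zero_prod_def
          intro: A_closed M_closed)
    show "ck_even A \<inter> ck_odd M = {0}"
      by (auto simp: ck_even_def ck_odd_def zero_prod_def intro: A_closed M_closed)
  next
    fix u v z :: "'g ck"
    show "ck_mult D (u + v) z = ck_mult D u z + ck_mult D v z"
      and "ck_mult D z (u + v) = ck_mult D z u + ck_mult D z v"
      by (cases u; cases v; cases z; auto simp: ck_mult_def D_rules algebra_simps)+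
  next
    fix u v :: "'g ck" and c
    show "ck_mult D (ck_scale scale c u) v = ck_scale scale c (ck_mult D u v)"
      and "ck_mult D u (ck_scale scale c v) = ck_scale scale c (ck_mult D u v)"
      by (cases u; cases v; auto simp: ck_mult_def ck_scale_def D_scale scale_mult_right
          scale_right_distrib scale_right_diff_distrib simp flip: scale_mult)+
  next
    fix u v :: "'g ck"
    show "u \<in> ck_even A \<Longrightarrow> v \<in> ck_even A \<Longrightarrow> ck_mult D u v \<in> ck_even A"
      by (auto simp: ck_mult_def ck_even_def zero_prod_def intro!: A_closed A_A)
    show "u \<in> ck_even A \<Longrightarrow> v \<in> ck_odd M \<Longrightarrow> ck_mult D u v \<in> ck_odd M"
      and "u \<in> ck_odd M \<Longrightarrow> v \<in> ck_even A \<Longrightarrow> ck_mult D u v \<in> ck_odd M"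
      by (auto simp: ck_mult_def ck_even_def ck_odd_def zero_prod_def intro!: M_closed A_M D_A)
    show "u \<in> ck_odd M \<Longrightarrow> v \<in> ck_odd M \<Longrightarrow> ck_mult D u v \<in> ck_even A"
      by (auto simp: ck_mult_def ck_even_def ck_odd_def zero_prod_def intro!: A_closed M_M D_M)
  qed
qed

sublocale ck: superalgebra "ck_scale scale" "ck_mult D" "ck_even A" "ck_odd M"
  by (rule superalgebra_ck)

lemma unital_superalgebra_ck:
  assumes "1 \<in> A"
  shows "unital_superalgebra (ck_scale scale) (ck_mult D) (ck_even A) (ck_odd M)"
proof unfold_locales
  have "ck_base 1 \<in> ck_even A + ck_odd M"
    using assms by (auto simp: ck_carrier ck_base_def zero_prod_def intro: A_closed M_closed)
  moreover have "ck_mult D (ck_base 1) u = u \<and> ck_mult D u (ck_base 1) = u" for u :: "'g ck"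
    by (cases u) (auto simp: ck_mult_def ck_base_def zero_prod_def)
  ultimately show "\<exists>e\<in>ck_even A + ck_odd M. \<forall>u\<in>ck_even A + ck_odd M.
      ck_mult D e u = u \<and> ck_mult D u e = u"
    by blast
qed

lemma scale_sign: "ck_scale scale ((-1) ^ n) u = (if even n then u else - u)"
  by (cases u) (auto simp: ck_scale_def)

text \<open>
  Explicit coordinates depending only on the parity of the degree turn the Jordan identities into
  finitely many identities in a commutative ring with derivation.
\<close>

lemma hom_part_cases:
  assumes "u \<in> ck.hom_part i"
  obtains u0 u1 u2 u3 where
    "u = (if even i then ((u0, u1, u2, u3), (0, 0, 0, 0)) else ((0, 0, 0, 0), (u0, u1, u2, u3)))"
  using assms unfolding ck.hom_part_def
  by (cases "even i"; cases u) (auto simp: ck_even_def ck_odd_def zero_prod_def)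

text \<open>
  Once the parities are fixed, each of the eight coordinates of a Jordan identity is an identity
  between polynomials in the coordinates of the arguments and their derivatives, and it follows from
  the commutative ring axioms and the Leibniz rule.
\<close>

lemma jordan_superalgebra_ck:
  "jordan_superalgebra (ck_scale scale) (ck_mult D) (ck_even A) (ck_odd M)"
proof unfold_locales
  fix i j k :: nat and a b c z :: "'g ck"
  assume "a \<in> ck.hom_part i"
  then obtain a0 a1 a2 a3
    where a: "a = (if even i then ((a0, a1, a2, a3), (0, 0, 0, 0)) else ((0, 0, 0, 0), (a0, a1, a2, a3)))"
    by (rule hom_part_cases)
  obtain z0 z1 z2 z3 y0 y1 y2 y3 where z: "z = ((z0, z1, z2, z3), (y0, y1, y2, y3))"
    by (metis surj_pair)
  show "ck_mult D (ck_mult D z (ck_mult D a a)) a = ck_mult D (ck_mult D z a) (ck_mult D a a)"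
    unfolding a z
    by (cases "even i"; simp add: ck_mult_def D_rules; auto simp: algebra_simps)
  assume "b \<in> ck.hom_part j"
  then obtain b0 b1 b2 b3
    where b: "b = (if even j then ((b0, b1, b2, b3), (0, 0, 0, 0)) else ((0, 0, 0, 0), (b0, b1, b2, b3)))"
    by (rule hom_part_cases)
  show "ck_mult D a b = ck_scale scale ((-1) ^ (i * j)) (ck_mult D b a)"
    unfolding a b scale_sign
    by (cases "even i"; cases "even j"; simp add: ck_mult_def algebra_simps)
  assume "c \<in> ck.hom_part k"
  then obtain c0 c1 c2 c3
    where c: "c = (if even k then ((c0, c1, c2, c3), (0, 0, 0, 0)) else ((0, 0, 0, 0), (c0, c1, c2, c3)))"
    by (rule hom_part_cases)
  show "ck_mult D (ck_mult D (ck_mult D z a) b) c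
         + ck_scale scale ((-1) ^ (i * j + i * k + j * k)) (ck_mult D (ck_mult D (ck_mult D z c) b) a)
         + ck_scale scale ((-1) ^ (j * k)) (ck_mult D z (ck_mult D (ck_mult D a c) b))
       = ck_mult D (ck_mult D z a) (ck_mult D b c)
         + ck_scale scale ((-1) ^ (i * j)) (ck_mult D (ck_mult D z b) (ck_mult D a c))
         + ck_scale scale ((-1) ^ (i * k + j * k)) (ck_mult D (ck_mult D z c) (ck_mult D a b))"
    \<comment> \<open>The signs are resolved before the products are expanded: both sides then become sums of
      monomials without case distinctions.\<close>
    unfolding a b c z scale_sign
    by (cases "even i"; cases "even j"; cases "even k";
        simp only: if_True if_False even_mult_iff even_add simp_thms;
        simp add: ck_mult_def D_rules; auto simp: algebra_simps)
qed

text \<open>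
  A graded ideal \<open>I\<close> is controlled by \<open>P = {a \<in> A. a \<in> I}\<close>. Multiplying an even element of
  \<open>I\<close> by suitable \<open>w\<^sub>i\<close> puts each of its \<open>w\<close>-coordinates, up to sign, into \<open>P\<close>; once these
  vanish, the element itself lies in \<open>P\<close>. Multiplying an odd element by \<open>bar n\<close> and
  \<open>x\<^sub>1 (bar n)\<close> gives even elements whose coordinates include, up to sign, all products of its
  own coordinates with \<open>n\<close>. Hence \<open>P = {0}\<close> forces \<open>I = {0}\<close>. The bracket makes \<open>P\<close> stable
  under \<open>p \<mapsto> D p * (m * n)\<close>, so a form of differential simplicity of \<open>A\<close> leaves only
  \<open>1 \<in> P\<close>, in which case \<open>I\<close> is everything.
\<close>

lemma simple_superalgebra_ck:
  assumes one: "1 \<in> A"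
    and faithful: "\<And>m. m \<in> M \<Longrightarrow> (\<And>n. n \<in> M \<Longrightarrow> m * n = 0) \<Longrightarrow> m = 0"
    and D_simple: "\<And>P. subspace P \<Longrightarrow> P \<subseteq> A \<Longrightarrow> (\<And>a p. a \<in> A \<Longrightarrow> p \<in> P \<Longrightarrow> a * p \<in> P) \<Longrightarrow>
      (\<And>p m n. p \<in> P \<Longrightarrow> m \<in> M \<Longrightarrow> n \<in> M \<Longrightarrow> D p * (m * n) \<in> P) \<Longrightarrow> P = {0} \<or> 1 \<in> P"
  shows "simple_superalgebra (ck_scale scale) (ck_mult D) (ck_even A) (ck_odd M)"
proof unfold_locales
  note [simp] = A_closed(1) M_closed(1)
  let ?J = "ck_even A + ck_odd M"
  let ?W = "\<lambda>a b c d. ((a, b, c, d), (0, 0, 0, 0)) :: 'g ck"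
  let ?B = "\<lambda>a b c d. ((0, 0, 0, 0), (a, b, c, d)) :: 'g ck"
  have "?W 1 0 0 0 \<in> ?J" using one by (simp add: ck_carrier)
  moreover have "ck_mult D (?W 1 0 0 0) (?W 1 0 0 0) \<noteq> 0"
    by (simp add: ck_mult_def zero_prod_def)
  ultimately show "\<exists>u\<in>?J. \<exists>v\<in>?J. ck_mult D u v \<noteq> 0" by blast

  fix I :: "'g ck set"
  assume "ck.graded_ideal I"
  then have I_subspace: "ck.subspace I" and I_J: "I \<subseteq> ?J"
    and I_graded: "I = (I \<inter> ck_even A) + (I \<inter> ck_odd M)"
    and I_right: "u \<in> I \<Longrightarrow> v \<in> ?J \<Longrightarrow> ck_mult D u v \<in> I"
    and I_left: "u \<in> I \<Longrightarrow> v \<in> ?J \<Longrightarrow> ck_mult D v u \<in> I" for u v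
    unfolding ck.graded_ideal_def by blast+
  define P where "P = {a \<in> A. ck_base a \<in> I}"
  have base: "?W a 0 0 0 \<in> I \<longleftrightarrow> a \<in> P" if "a \<in> A" for a
    using that by (simp add: P_def ck_base_def zero_prod_def)
  have "subspace P"
    unfolding subspace_def
  proof (intro conjI ballI allI)
    show "0 \<in> P"
      using ck.subspace_0[OF I_subspace] by (simp add: P_def ck_base_def zero_prod_def)
  next
    fix a b assume "a \<in> P" "b \<in> P"
    then show "a + b \<in> P"
      using ck.subspace_add[OF I_subspace, of "ck_base a" "ck_base b"]
      by (simp add: P_def ck_base_def A_closed)
  next
    fix c a assume "a \<in> P"
    then show "scale c a \<in> P"
      using ck.subspace_scale[OF I_subspace, of "ck_base a" c]
      by (simp add: P_def ck_base_def ck_scale_def zero_prod_def A_closed)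
  qed
  moreover have "P \<subseteq> A" by (auto simp: P_def)
  moreover have "a * p \<in> P" if "a \<in> A" "p \<in> P" for a p
  proof -
    have "p \<in> A" "?W p 0 0 0 \<in> I" using that base by (auto simp: P_def)
    then have "ck_mult D (?W a 0 0 0) (?W p 0 0 0) \<in> I"
      using that by (intro I_left) (auto simp: ck_carrier)
    then show ?thesis using that \<open>p \<in> A\<close> by (simp add: ck_mult_def base A_A)
  qed
  moreover have "D p * (m * n) \<in> P" if "p \<in> P" "m \<in> M" "n \<in> M" for p m n
  proof -
    have p: "p \<in> A" "?W p 0 0 0 \<in> I" using that base by (auto simp: P_def)
    have "ck_mult D (?W p 0 0 0) (?B m 0 0 0) \<in> I"
      using p that by (intro I_right) (auto simp: ck_carrier)
    then have "ck_mult D (ck_mult D (?W p 0 0 0) (?B m 0 0 0)) (?B n 0 0 0) \<in> I"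
      using that by (intro I_right[of _ "?B n 0 0 0"]) (auto simp: ck_carrier)
    then have "?W (D (p * m) * n - p * m * D n) 0 0 0 \<in> I"
      by (simp add: ck_mult_def)
    moreover have "D (p * m) * n - p * m * D n \<in> A"
      using p that by (intro A_closed M_M D_M A_M)
    ultimately have "D (p * m) * n - p * m * D n \<in> P"
      by (simp add: base)
    moreover have "(D m * n - m * D n) * p \<in> P"
      using that p by (intro \<open>\<And>a p. a \<in> A \<Longrightarrow> p \<in> P \<Longrightarrow> a * p \<in> P\<close> A_closed M_M D_M)
    \<comment> \<open>The bracket of \<open>bar (p m)\<close> and \<open>bar n\<close> is the wanted element plus
      \<open>p\<close> times the bracket of \<open>bar m\<close> and \<open>bar n\<close>.\<close>
    ultimately have "D (p * m) * n - p * m * D n - (D m * n - m * D n) * p \<in> P"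
      using \<open>subspace P\<close> by (rule subspace_diff[rotated])
    then show ?thesis by (simp add: D_mult algebra_simps)
  qed
  ultimately consider "P = {0}" | "1 \<in> P" using D_simple[of P] by blast
  then show "I = {0} \<or> I = ?J"
  proof cases
    case 1
    have even: "u = 0" if u_I: "u \<in> I \<inter> ck_even A" for u
    proof -
      obtain a0 a1 a2 a3 where u: "u = ?W a0 a1 a2 a3"
        and A: "a0 \<in> A" "a1 \<in> A" "a2 \<in> A" "a3 \<in> A"
        using u_I by (auto simp: ck_even_def zero_prod_def)
      have w: "?W 0 1 0 0 \<in> ?J" "?W 0 0 1 0 \<in> ?J"
        using one by (auto simp: ck_carrier)
      \<comment> \<open>Multiplication by \<open>w\<^sub>1\<close> moves \<open>a1\<close> to the first coordinate and \<open>a0\<close> to the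
        second; multiplying twice by \<open>w\<^sub>2\<close> then keeps only \<open>a1\<close>.\<close>
      have "a1 \<in> P"
        using I_left[OF I_left[OF I_left[OF IntD1[OF u_I] w(1)] w(2)] w(2)] A
        by (simp add: u ck_mult_def base)
      moreover have "a2 \<in> P"
        using I_left[OF I_left[OF I_left[OF IntD1[OF u_I] w(2)] w(1)] w(1)] A
        by (simp add: u ck_mult_def base)
      moreover have "- a3 \<in> P"
      proof -
        have "?W 0 0 0 1 \<in> ?J" using one by (auto simp: ck_carrier)
        from I_left[OF I_left[OF I_left[OF IntD1[OF u_I] this] w(1)] w(1)]
        show ?thesis
          using A by (simp add: u ck_mult_def base subspace_neg[OF A_subspace])
      qed
      ultimately have "a1 = 0" "a2 = 0" "a3 = 0" using 1 by auto
      moreover from this have "a0 \<in> P" using u_I A by (simp add: u base)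
      ultimately show "u = 0" using 1 by (simp add: u zero_prod_def)
    qed
    have odd: "u = 0" if u_I: "u \<in> I \<inter> ck_odd M" for u
    proof -
      obtain b0 b1 b2 b3 where u: "u = ?B b0 b1 b2 b3"
        and M: "b0 \<in> M" "b1 \<in> M" "b2 \<in> M" "b3 \<in> M"
        using u_I by (auto simp: ck_odd_def zero_prod_def)
      have "b1 * n = 0 \<and> b2 * n = 0 \<and> b3 * n = 0 \<and> b0 * n = 0" if "n \<in> M" for n
      proof -
        have "ck_mult D u v = 0" if "v \<in> {?B n 0 0 0, ?B 0 n 0 0}" for v
        proof (rule even)
          have "v \<in> ?J"
            using that \<open>n \<in> M\<close> by (auto simp: ck_carrier)
          moreover have "v \<in> ck_odd M"
            using that \<open>n \<in> M\<close> by (auto simp: ck_odd_def zero_prod_def)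
          ultimately show "ck_mult D u v \<in> I \<inter> ck_even A"
            using u_I I_right ck.odd_odd by blast
        qed
        from this[of "?B n 0 0 0"] this[of "?B 0 n 0 0"] show ?thesis
          by (simp add: u ck_mult_def zero_prod_def)
      qed
      then show ?thesis using faithful M by (auto simp: u zero_prod_def)
    qed
    have "I \<subseteq> {0}"
    proof
      fix u assume "u \<in> I"
      then obtain v w where "u = v + w" "v \<in> I \<inter> ck_even A" "w \<in> I \<inter> ck_odd M"
        using I_graded set_plus_elim by metis
      then show "u \<in> {0}" using even[of v] odd[of w] by simp
    qed
    then show ?thesis using ck.subspace_0[OF I_subspace] by blast
  next
    case 2
    have "?J \<subseteq> I"
    proof
      fix u assume "u \<in> ?J"
      then have "ck_mult D (?W 1 0 0 0) u \<in> I"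
        using 2 one base by (intro I_right) auto
      then show "u \<in> I" by (cases u) (auto simp: ck_mult_def zero_prod_def)
    qed
    then show ?thesis using I_J by blast
  qed
qed

end


section \<open>Ideals of \<open>F[t]\<close> stable under differential operators\<close>

text \<open>
  An ideal containing \<open>(t - \<alpha>) w\<close> and \<open>u w\<close> contains \<open>u(\<alpha>) w\<close>, because \<open>u - u(\<alpha>)\<close> is a
  multiple of \<open>t - \<alpha>\<close>. Cancelling one root at a time replaces a Bezout
  identity between \<open>u\<close> and the product of the linear factors.
\<close>

lemma linear_factors_cancel:
  fixes Q :: "'f::field poly set"
  assumes diff: "\<And>f g. f \<in> Q \<Longrightarrow> g \<in> Q \<Longrightarrow> f - g \<in> Q"
    and mult: "\<And>f g. g \<in> Q \<Longrightarrow> f * g \<in> Q"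
    and "finite S"
    and "\<And>\<alpha>. \<alpha> \<in> S \<Longrightarrow> poly u \<alpha> \<noteq> 0"
    and "(\<Prod>\<alpha>\<in>S. [:- \<alpha>, 1:]) * v \<in> Q"
    and "u * v \<in> Q"
  shows "v \<in> Q"
  using assms(3-)
proof (induction S arbitrary: v rule: finite_induct)
  case empty
  then show ?case by simp
next
  case (insert \<alpha> S)
  define l where "l = [:- \<alpha>, 1:]"
  have lv: "l * v \<in> Q"
  proof (rule insert.IH)
    show "(\<Prod>\<beta>\<in>S. [:- \<beta>, 1:]) * (l * v) \<in> Q"
      using insert.prems(2) insert.hyps by (simp add: ac_simps flip: l_def)
    show "u * (l * v) \<in> Q"
      using mult[OF insert.prems(3), of l] by (simp only: ac_simps)
  qed (use insert.prems in auto)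
  have "l dvd u - [:poly u \<alpha>:]"
    unfolding l_def by (subst poly_eq_0_iff_dvd[symmetric]) simp
  then obtain k where k: "u - [:poly u \<alpha>:] = l * k" ..
  have "[:poly u \<alpha>:] * v = u * v - k * (l * v)"
  proof -
    have "[:poly u \<alpha>:] = u - l * k" by (simp only: k[symmetric], simp)
    then have "[:poly u \<alpha>:] * v = (u - l * k) * v" by (rule arg_cong)
    then show ?thesis by (simp add: algebra_simps)
  qed
  also have "\<dots> \<in> Q" by (rule diff[OF insert.prems(3) mult[OF lv]])
  finally have "[:inverse (poly u \<alpha>):] * ([:poly u \<alpha>:] * v) \<in> Q" by (rule mult)
  then show ?case using insert.prems(1)[of \<alpha>] by simp
qed

text \<open>
  The logarithmic derivative \<open>g' / g\<close> has residue equal to the multiplicity of \<open>\<alpha>\<close> in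
  \<open>g\<close>; here \<open>c = (t - \<alpha>) s g' / g\<close> is a polynomial.
\<close>

lemma log_derivative_residue:
  fixes g :: "'f::field_char_0 poly"
  assumes "g \<noteq> 0" and "[:- \<alpha>, 1:] * s * pderiv g = g * c"
  shows "poly c \<alpha> = of_nat (order \<alpha> g) * poly s \<alpha>"
proof -
  define l where "l = [:- \<alpha>, 1:]"
  define m where "m = order \<alpha> g"
  obtain h where g: "g = l ^ m * h" and "\<not> l dvd h"
    using order_decomp[OF assms(1), of \<alpha>] unfolding l_def m_def by blast
  then have h: "poly h \<alpha> \<noteq> 0" by (simp add: poly_eq_0_iff_dvd l_def)
  have [simp]: "pderiv l = 1" by (simp add: l_def pderiv_pCons one_pCons)
  have [simp]: "poly l \<alpha> = 0" by (simp add: l_def)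
  have "l \<noteq> 0" by (simp add: l_def)
  have "l * pderiv (l ^ m) = smult (of_nat m) (l ^ m)"
    by (cases m) (simp_all add: pderiv_power_Suc ac_simps del: power_Suc, simp)
  then have "l * pderiv g = l ^ m * (smult (of_nat m) h + l * pderiv h)"
    by (simp add: g pderiv_mult algebra_simps)
  then have "l ^ m * (s * (smult (of_nat m) h + l * pderiv h)) = s * (l * pderiv g)"
    by (simp only: ac_simps)
  also have "\<dots> = l ^ m * (h * c)"
    using assms(2) unfolding l_def[symmetric] by (simp only: g ac_simps)
  finally have "l ^ m * (s * (smult (of_nat m) h + l * pderiv h)) = l ^ m * (h * c)" .
  then have "s * (smult (of_nat m) h + l * pderiv h) = h * c"
    using \<open>l \<noteq> 0\<close> by simp
  then have "poly (s * (smult (of_nat m) h + l * pderiv h)) \<alpha> = poly (h * c) \<alpha>"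
    by simp
  then show ?thesis using h by (simp add: m_def mult.commute)
qed

text \<open>
  The two closure conditions are what stability under the derivation of the curve leaves on the
  polynomials in \<open>t = y\<^sup>2\<close>. Take \<open>g\<close> of least degree in \<open>Q\<close>. By division \<open>g\<close> divides
  \<open>q g'\<close>; put \<open>c = q g' / g\<close>. Differentiating \<open>q g' = g c\<close> and comparing with the second
  condition gives \<open>(2 c - q') g' \<in> Q\<close>. At a root \<open>\<alpha>\<close> of \<open>q\<close>, with multiplicity \<open>m\<close> in
  \<open>g\<close>, the factor \<open>2 c - q'\<close> takes the value \<open>(2 m - 1) q'(\<alpha>) \<noteq> 0\<close>, so it is coprime
  to \<open>q\<close> and \<open>g' \<in> Q\<close>. By minimality \<open>g' = 0\<close>, and \<open>g\<close> is a nonzero constant.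
\<close>

lemma differential_ideal_contains_one:
  fixes Q :: "'f::field_char_0 poly set"
  assumes diff: "\<And>f g. f \<in> Q \<Longrightarrow> g \<in> Q \<Longrightarrow> f - g \<in> Q"
    and mult: "\<And>f g. g \<in> Q \<Longrightarrow> f * g \<in> Q"
    and "finite S" and q: "q = (\<Prod>\<alpha>\<in>S. [:- \<alpha>, 1:])"
    and first: "\<And>f. f \<in> Q \<Longrightarrow> q * pderiv f \<in> Q"
    and second: "\<And>f. f \<in> Q \<Longrightarrow> pderiv q * pderiv f + 2 * q * pderiv (pderiv f) \<in> Q"
    and "f \<in> Q" "f \<noteq> 0"
  shows "1 \<in> Q"
proof -
  obtain g where g: "g \<in> Q" "g \<noteq> 0" and least: "\<And>f. f \<in> Q \<Longrightarrow> f \<noteq> 0 \<Longrightarrow> degree g \<le> degree f"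
    using arg_min_natI[of "\<lambda>f. f \<in> Q \<and> f \<noteq> 0" f degree]
      arg_min_nat_le[of "\<lambda>f. f \<in> Q \<and> f \<noteq> 0" _ degree] assms(7,8)
    by blast
  have small: "f = 0" if "f \<in> Q" "degree f < degree g" for f
    using least[OF that(1)] that(2) by force
  have "degree g = 0"
  proof (rule ccontr)
    assume deg: "degree g \<noteq> 0"
    have "q * pderiv g mod g = q * pderiv g - (q * pderiv g div g) * g"
      by (simp add: minus_div_mult_eq_mod)
    also have "\<dots> \<in> Q" using g by (intro diff mult first)
    finally have "q * pderiv g mod g = 0"
      using small degree_mod_less'[of g "q * pderiv g"] g(2) by blast
    then obtain c where c: "q * pderiv g = g * c" by (elim mod_0_imp_dvd[THEN dvdE])
    define u where "u = 2 * c - pderiv q"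
    have "pderiv q * pderiv g + q * pderiv (pderiv g) = pderiv g * c + g * pderiv c"
      using arg_cong[OF c, of pderiv] by (simp add: pderiv_mult algebra_simps)
    then have "u * pderiv g = pderiv q * pderiv g + 2 * q * pderiv (pderiv g) - (2 * pderiv c) * g"
      unfolding u_def by algebra
    also have "\<dots> \<in> Q" using g by (intro diff mult second)
    finally have ug: "u * pderiv g \<in> Q" .
    have "poly u \<alpha> \<noteq> 0" if "\<alpha> \<in> S" for \<alpha>
    proof -
      define s where "s = (\<Prod>\<beta>\<in>S - {\<alpha>}. [:- \<beta>, 1:])"
      have q_s: "q = [:- \<alpha>, 1:] * s"
        using that \<open>finite S\<close> unfolding q s_def by (simp only: prod.remove)
      have "poly s \<alpha> \<noteq> 0"
        using \<open>finite S\<close> by (simp add: s_def poly_prod)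
      moreover have "poly (pderiv q) \<alpha> = poly s \<alpha>"
        unfolding q_s by (simp only: pderiv_mult) (simp add: pderiv_pCons)
      moreover have "poly c \<alpha> = of_nat (order \<alpha> g) * poly s \<alpha>"
        using log_derivative_residue[OF g(2)] c unfolding q_s by blast
      moreover have "of_nat (2 * order \<alpha> g) \<noteq> (of_nat 1 :: 'f)"
        by (subst of_nat_eq_iff) presburger
      ultimately show ?thesis by (simp add: u_def)
    qed
    then have "pderiv g \<in> Q"
      using linear_factors_cancel[of Q S u "pderiv g"] diff mult \<open>finite S\<close> ug first[OF g(1)]
      unfolding q by blast
    then have "pderiv g = 0"
      using deg by (intro small) (simp_all add: degree_pderiv)
    then show False using deg by (simp add: pderiv_eq_0_iff)
  qed
  then obtain c where "g = [:c:]" by (rule degree_eq_zeroE)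
  then have "1 = [:inverse c:] * g" using g(2) by (simp add: one_pCons)
  then show ?thesis using mult[OF g(1)] by metis
qed


section \<open>Differential simplicity of the even part of the curve ring\<close>

text \<open>
  The substitution \<open>t \<mapsto> y\<^sup>2\<close>, a ring homomorphism from \<open>F[t]\<close> to the curve ring.
\<close>

lift_definition even_in_y :: "'f::field poly \<Rightarrow> 'f curve_ring" is
  "\<lambda>p. [:pcompose p [:0, 0, 1:]:]" .

lemma even_in_y_add: "even_in_y (p + r) = even_in_y p + even_in_y r"
  by transfer (simp add: pcompose_add)

lemma even_in_y_diff: "even_in_y (p - r) = even_in_y p - even_in_y r"
  by transfer (simp add: pcompose_diff)

lemma even_in_y_mult: "even_in_y (p * r) = even_in_y p * even_in_y r"
  by transfer (simp add: pcompose_mult)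

lemma even_in_y_0 [simp]: "even_in_y 0 = 0"
  by transfer simp

lemma even_in_y_1 [simp]: "even_in_y 1 = 1"
  by transfer (simp add: one_pCons)

lemma even_in_y_power: "even_in_y (p ^ n) = even_in_y p ^ n"
  by (induction n) (simp_all add: even_in_y_mult)

lemma even_in_y_numeral: "even_in_y (numeral n) = numeral n"
proof -
  have "even_in_y (of_nat k) = of_nat k" for k
    by (induction k) (simp_all add: even_in_y_add)
  from this[of "numeral n"] show ?thesis by simp
qed

lemma even_in_y_pCons: "even_in_y (pCons c p) = curve_scale c 1 + cY ^ 2 * even_in_y p"
proof -
  have "even_in_y (pCons c p) = curve_scale c 1 + cY * cY * even_in_y p"
    by transfer (simp add: pcompose_pCons pY_def)
  then show ?thesis by (simp add: power2_eq_square)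
qed

lemma even_in_y_smult: "even_in_y (smult c p) = curve_scale c (even_in_y p)"
  by transfer (simp add: pcompose_smult)

interpretation curve: vector_space "curve_scale :: 'f::field \<Rightarrow> _"
  by (rule vector_space_curve_scale)

interpretation curve: ring_derivation "curve_D :: 'f::field curve_ring \<Rightarrow> _"
  using derivation_curve_D[where 'a = 'f] unfolding derivation_def
  by unfold_locales (auto simp: Vector_Spaces.linear_iff)

lemma curve_D_scale: "curve_D (curve_scale c a) = curve_scale c (curve_D a)"
  using derivation_curve_D unfolding derivation_def by (auto simp: Vector_Spaces.linear_iff)

lemma curve_D_even_in_y: "curve_D (even_in_y p) = - 2 * cX * cY * even_in_y (pderiv p)"
proof (induction p)
  case 0
  then show ?case by simp
next
  case (pCons c p)
  have "curve_D (curve_scale c 1) = (0 :: 'a curve_ring)"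
    by (simp add: curve_D_scale)
  then show ?case
    by (simp add: even_in_y_pCons pderiv_pCons even_in_y_add power2_eq_square
        curve.D_rules curve_D_cY pCons.IH algebra_simps)
qed

lemma cX_cX: "cX * cX = (1 - cY ^ 4 :: 'f::field curve_ring)"
  using curve_equation[where 'f = 'f] by (simp add: power2_eq_square eq_diff_eq)

lemma even_in_y_t: "even_in_y [:0, 1:] = cY ^ 2"
  by (simp add: even_in_y_pCons)

text \<open>
  Together with \<open>x\<^sup>2 = 1 - y\<^sup>4\<close> this rewrites every expression to the form \<open>f(y) + x g(y)\<close>,
  also when \<open>x\<^sup>2\<close> occurs inside a longer product.
\<close>

lemma cX_cX_left: "cX * (cX * a) = (1 - cY ^ 4) * (a :: 'f::field curve_ring)"
  by (simp add: cX_cX flip: mult.assoc)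

lemmas curve_normal_form = algebra_simps power2_eq_square power3_eq_cube power4_eq_xxxx
  cX_cX cX_cX_left

lemma subalgebra_curve_A: "subalgebra curve_scale curve_A"
  unfolding curve_A_def
  by (rule hull_in) (auto simp: subalgebra_def intro!: curve.subspace_Inter)

lemma curve_A_closed:
  shows curve_A_subspace: "curve.subspace curve_A"
    and curve_A_mult: "a \<in> curve_A \<Longrightarrow> b \<in> curve_A \<Longrightarrow> a * b \<in> curve_A"
  using subalgebra_curve_A by (auto simp: subalgebra_def)

lemma curve_A_generators: "1 \<in> curve_A" "cY ^ 2 \<in> curve_A" "cX * cY \<in> curve_A"
  using hull_subset[of "{1, cY ^ 2, cX * cY}" "subalgebra curve_scale"]
  unfolding curve_A_def by auto

lemma even_in_y_in_curve_A: "even_in_y p \<in> curve_A"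
  by (induction p)
     (auto simp: even_in_y_pCons intro!: curve.subspace_0 curve.subspace_add curve.subspace_scale
       curve_A_closed curve_A_generators)

text \<open>
  With \<open>t = y\<^sup>2\<close> and \<open>w = x y\<close>, the algebra \<open>A\<close> is the coordinate ring of the cubic
  \<open>w\<^sup>2 = - (t\<^sup>3 - t)\<close>.
\<close>

definition cubic :: "'f::field poly" where
  "cubic = [:0, 1:] ^ 3 - [:0, 1:]"

lemma pderiv_cubic: "pderiv cubic = 3 * [:0, 1:] ^ 2 - 1"
  by (simp add: cubic_def pderiv_diff pderiv_power pderiv_pCons one_pCons numeral_poly)

lemma even_in_y_cubic: "even_in_y cubic = - (cX * cY) * (cX * cY :: 'f::field curve_ring)"
proof -
  have "even_in_y cubic = cY ^ 2 * cY ^ 2 * cY ^ 2 - (cY ^ 2 :: 'f curve_ring)"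
    unfolding cubic_def power3_eq_cube even_in_y_mult even_in_y_diff even_in_y_t by simp
  then show ?thesis by (simp add: curve_normal_form)
qed

lemmas even_in_y_rules = even_in_y_add even_in_y_diff even_in_y_mult even_in_y_power
  even_in_y_numeral even_in_y_1 even_in_y_t even_in_y_cubic

text \<open>
  Modulo the cubic equation every element of \<open>A\<close> is linear in \<open>w = x y\<close> over \<open>F[t]\<close>.
\<close>

lemma curve_A_eq: "curve_A = {even_in_y p + cX * cY * even_in_y r | p r. True}"
  (is "_ = ?E")
proof
  have E: "even_in_y p + cX * cY * even_in_y r \<in> ?E" for p r :: "'a poly"
    by blast
  have "curve.subspace ?E"
    unfolding curve.subspace_def
  proof (intro conjI ballI allI)
    show "0 \<in> ?E" using E[of 0 0] by simp
  next
    fix a b assume "a \<in> ?E" "b \<in> ?E"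
    then obtain p r p' r' where ab: "a = even_in_y p + cX * cY * even_in_y r"
      "b = even_in_y p' + cX * cY * even_in_y r'"
      by blast
    show "a + b \<in> ?E"
      using E[of "p + p'" "r + r'"] by (simp add: ab even_in_y_add algebra_simps)
  next
    fix c a assume "a \<in> ?E"
    then obtain p r where a: "a = even_in_y p + cX * cY * even_in_y r"
      by blast
    have "curve_scale c (cX * cY * even_in_y r) = cX * cY * curve_scale c (even_in_y r)"
      using curve_scale_mult[of c "even_in_y r" "cX * cY"] by (simp add: mult.commute)
    then show "curve_scale c a \<in> ?E"
      using E[of "smult c p" "smult c r"]
      by (simp add: a even_in_y_smult curve.scale_right_distrib)
  qed
  moreover have "a * b \<in> ?E" if E_mem: "a \<in> ?E" "b \<in> ?E" for a b
  proof -
    obtain p r p' r' where ab: "a = even_in_y p + cX * cY * even_in_y r"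
      "b = even_in_y p' + cX * cY * even_in_y r'"
      using E_mem by blast
    have "a * b = even_in_y (p * p' - cubic * r * r') + cX * cY * even_in_y (p * r' + r * p')"
      unfolding ab even_in_y_rules by (simp add: curve_normal_form)
    then show ?thesis using E by simp
  qed
  ultimately have "subalgebra curve_scale ?E"
    unfolding subalgebra_def by blast
  moreover have "{1, cY ^ 2, cX * cY} \<subseteq> ?E"
    using E[of 1 0] E[of "[:0, 1:]" 0] E[of 0 1] by (auto simp: even_in_y_t)
  ultimately show "curve_A \<subseteq> ?E"
    unfolding curve_A_def by (intro hull_minimal)
  show "?E \<subseteq> curve_A"
    using curve.subspace_add[OF curve_A_subspace] curve_A_mult curve_A_generators
      even_in_y_in_curve_A by blast
qed

lemma cX_cX_in_curve_A: "cX * cX \<in> curve_A"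
proof -
  have "cX * cX = 1 - cY ^ 2 * (cY ^ 2 :: 'a curve_ring)"
    by (simp add: curve_normal_form)
  also have "\<dots> \<in> curve_A"
    by (intro curve.subspace_diff[OF curve_A_subspace] curve_A_mult curve_A_generators)
  finally show ?thesis .
qed

lemma curve_D_A: "a \<in> curve_A \<Longrightarrow> curve_D a \<in> curve_A"
proof -
  assume "a \<in> curve_A"
  then obtain p r where a: "a = even_in_y p + cX * cY * even_in_y r"
    unfolding curve_A_eq by blast
  have "curve_D a = even_in_y ((3 * [:0, 1:] ^ 2 - 1) * r + 2 * cubic * pderiv r)
      - cX * cY * even_in_y (2 * pderiv p)"
    unfolding a curve.D_rules curve_D_even_in_y curve_D_cX curve_D_cY even_in_y_rules
    by (simp add: curve_normal_form)
  also have "\<dots> \<in> curve_A"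
    by (intro curve.subspace_diff[OF curve_A_subspace] curve_A_mult curve_A_generators
        even_in_y_in_curve_A)
  finally show ?thesis .
qed

lemma mem_curve_M: "m \<in> curve_M \<longleftrightarrow> (\<exists>a\<in>curve_A. \<exists>b\<in>curve_A. m = cX * a + cY * b)"
  by (auto simp: curve_M_def set_plus_def)

interpretation gck: ck_pair curve_D "curve_scale :: 'f::field \<Rightarrow> _" curve_A curve_M
proof
  note A = curve_A_closed curve_A_generators curve.subspace_add[OF curve_A_subspace]
    curve.subspace_diff[OF curve_A_subspace] cX_cX_in_curve_A curve_D_A
  have M: "cX * a + cY * b \<in> curve_M" if "a \<in> curve_A" "b \<in> curve_A" for a b :: "'f curve_ring"
    using that by (auto simp: mem_curve_M)
  fix a b m n :: "'f curve_ring" and c :: 'f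
  show "curve_scale c (a * b) = curve_scale c a * b" by (rule curve_scale_mult)
  show "curve_D (curve_scale c a) = curve_scale c (curve_D a)" by (rule curve_D_scale)
  show "curve.subspace (curve_A :: 'f curve_ring set)" by (rule curve_A_subspace)
  show "curve.subspace (curve_M :: 'f curve_ring set)"
    unfolding curve.subspace_def
  proof (intro conjI ballI allI)
    show "0 \<in> (curve_M :: 'f curve_ring set)"
      using M[of 0 0] curve.subspace_0[OF curve_A_subspace] by simp
  next
    fix m n :: "'f curve_ring" assume "m \<in> curve_M" "n \<in> curve_M"
    then obtain e f e' f' where m: "m = cX * e + cY * f" "n = cX * e' + cY * f'"
       "e \<in> curve_A" "f \<in> curve_A" "e' \<in> curve_A" "f' \<in> curve_A"
      by (auto simp: mem_curve_M)
    then show "m + n \<in> curve_M"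
      using M[of "e + e'" "f + f'"] by (simp add: A algebra_simps)
  next
    fix m :: "'f curve_ring" and c assume "m \<in> curve_M"
    then obtain e f where m: "m = cX * e + cY * f" "e \<in> curve_A" "f \<in> curve_A"
      by (auto simp: mem_curve_M)
    have "curve_scale c m = cX * curve_scale c e + cY * curve_scale c f"
      using curve_scale_mult[of c e cX] curve_scale_mult[of c f cY]
      by (simp add: m curve.scale_right_distrib mult.commute)
    then show "curve_scale c m \<in> curve_M"
      using M m curve.subspace_scale[OF curve_A_subspace] by metis
  qed
  show "a \<in> curve_A \<Longrightarrow> b \<in> curve_A \<Longrightarrow> a * b \<in> curve_A" by (rule curve_A_mult)
  show "curve_D a \<in> curve_A" if "a \<in> curve_A" using that by (rule curve_D_A)
  show "a * m \<in> curve_M" if am: "a \<in> curve_A" "m \<in> curve_M"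
  proof -
    obtain e f where m: "m = cX * e + cY * f" "e \<in> curve_A" "f \<in> curve_A"
      using am by (auto simp: mem_curve_M)
    show ?thesis
      using M[of "a * e" "a * f"] m am by (simp add: A algebra_simps)
  qed
  show "m * n \<in> curve_A" if mn: "m \<in> curve_M" "n \<in> curve_M"
  proof -
    obtain e f e' f' where m: "m = cX * e + cY * f" "n = cX * e' + cY * f'"
       "e \<in> curve_A" "f \<in> curve_A" "e' \<in> curve_A" "f' \<in> curve_A"
      using mn by (auto simp: mem_curve_M)
    have "m * n = cX * cX * (e * e') + cX * cY * (e * f' + f * e') + cY ^ 2 * (f * f')"
      unfolding m by (simp add: curve_normal_form)
    then show ?thesis
      using m by (simp add: A)
  qed
  show "curve_D m \<in> curve_M" if m_M: "m \<in> curve_M"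
  proof -
    obtain e f where m: "m = cX * e + cY * f" "e \<in> curve_A" "f \<in> curve_A"
      using m_M by (auto simp: mem_curve_M)
    have "curve_D m = cX * (curve_D e - f) + cY * (cY ^ 2 * e + cY ^ 2 * e + curve_D f)"
      unfolding m curve.D_rules curve_D_cX curve_D_cY by (simp add: curve_normal_form)
    also have "\<dots> \<in> curve_M"
      using m(2,3) by (intro M A)
    finally show ?thesis .
  qed
qed

text \<open>
  Multiplying \<open>p(t) + w r(t)\<close> by its conjugate \<open>p(t) - w r(t)\<close> gives the norm
  \<open>p\<^sup>2 + (t\<^sup>3 - t) r\<^sup>2\<close>. Its two summands have degrees of different parity, so it vanishes only
  if \<open>p = r = 0\<close>. A nonzero ideal of \<open>A\<close> therefore meets \<open>F[t]\<close> nontrivially.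
\<close>

lemma curve_A_conjugate_product_nonzero:
  assumes "a \<in> curve_A" "a \<noteq> 0"
  obtains b f where "b \<in> curve_A" "b * a = even_in_y f" "f \<noteq> 0"
proof -
  obtain p r where a: "a = even_in_y p + cX * cY * even_in_y r"
    using assms unfolding curve_A_eq by blast
  show ?thesis
  proof
    have "even_in_y p + cX * cY * even_in_y (- r) \<in> curve_A"
      unfolding curve_A_eq by blast
    then show "even_in_y p - cX * cY * even_in_y r \<in> curve_A"
      using even_in_y_diff[of 0 r] by simp
    show "(even_in_y p - cX * cY * even_in_y r) * a = even_in_y (p * p + cubic * (r * r))"
      unfolding a even_in_y_rules by (simp add: curve_normal_form)
    show "p * p + cubic * (r * r) \<noteq> 0"
    proof
      assume "p * p + cubic * (r * r) = 0"
      then have eq: "p * p = - (cubic * (r * r))" by (simp add: eq_neg_iff_add_eq_0)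
      have cubic: "degree (cubic :: 'a poly) = 3" "cubic \<noteq> (0 :: 'a poly)"
        by (simp_all add: cubic_def power3_eq_cube)
      show False
      proof (cases "r = 0")
        case True
        then show False using eq assms(2) a by simp
      next
        case False
        then have "p \<noteq> 0" using eq cubic by auto
        then have "degree p + degree p = 3 + (degree r + degree r)"
          using arg_cong[OF eq, of degree] False cubic by (simp add: degree_mult_eq)
        then show False by presburger
      qed
    qed
  qed
qed

lemma cubic_eq_prod: "cubic = (\<Prod>\<alpha>\<in>{0, 1, - 1 :: 'f::field_char_0}. [:- \<alpha>, 1:])"
  by (simp add: cubic_def power3_eq_cube)

text \<open>
  On \<open>f(t)\<close> the operators \<open>x y D\<close> and \<open>D\<^sup>2\<close> are, up to the invertible factors \<open>2\<close> and \<open>-2\<close>,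
  the operators \<open>q f'\<close> and \<open>q' f' + 2 q f''\<close> with \<open>q = t\<^sup>3 - t\<close>. Since \<open>q\<close> has the
  simple roots \<open>0, 1, -1\<close> over every field of characteristic 0, the polynomial lemma applies
  to the trace of a \<open>D\<close>-stable ideal on \<open>F[t]\<close>.
\<close>

lemma curve_A_D_simple:
  fixes P :: "'f::field_char_0 curve_ring set"
  assumes P: "curve.subspace P" "P \<subseteq> curve_A"
    and ideal: "\<And>a p. a \<in> curve_A \<Longrightarrow> p \<in> P \<Longrightarrow> a * p \<in> P"
    and D: "\<And>p. p \<in> P \<Longrightarrow> curve_D p \<in> P"
  shows "P = {0} \<or> 1 \<in> P"
proof -
  have "1 \<in> P" if a_P: "a \<in> P" "a \<noteq> 0" for a
  proof -
    define Q where "Q = {f. even_in_y f \<in> P}"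
    obtain b f where bf: "b \<in> curve_A" "b * a = even_in_y f" "f \<noteq> 0"
      using curve_A_conjugate_product_nonzero a_P P(2) by blast
    note scale = curve.subspace_scale[OF P(1)]
    have half: "even_in_y g \<in> P" if "2 * even_in_y g \<in> P" for g
    proof -
      have "2 * even_in_y g = curve_scale 2 (even_in_y g)"
        using curve.scale_left_distrib[of 1 1 "even_in_y g"] by simp
      then show ?thesis using scale[OF that, of "1 / 2"] by simp
    qed
    have "1 \<in> Q"
    proof (rule differential_ideal_contains_one[of Q "{0, 1, -1}" cubic f])
      show "f \<in> Q" using bf ideal[of b a] a_P by (simp add: Q_def)
      show "g - h \<in> Q" if "g \<in> Q" "h \<in> Q" for g h
        using that curve.subspace_diff[OF P(1)] by (simp add: Q_def even_in_y_diff)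
      show "g * h \<in> Q" if "h \<in> Q" for g h
        using that by (auto simp: Q_def even_in_y_mult intro: ideal even_in_y_in_curve_A)
    next
      fix g assume "g \<in> Q"
      then have g: "even_in_y g \<in> P" by (simp add: Q_def)
      have "cX * cY * curve_D (even_in_y g) \<in> P"
        using g by (intro ideal D curve_A_generators)
      also have "cX * cY * curve_D (even_in_y g) = 2 * even_in_y (cubic * pderiv g)"
        unfolding curve_D_even_in_y even_in_y_rules by (simp add: curve_normal_form)
      finally show "cubic * pderiv g \<in> Q" using half by (simp add: Q_def)
      have "curve_D (curve_D (even_in_y g)) \<in> P"
        using g by (intro D)
      also have "curve_D (curve_D (even_in_y g))
          = - 2 * even_in_y (pderiv cubic * pderiv g + 2 * cubic * pderiv (pderiv g))"
        unfolding curve_D_even_in_y curve.D_rules curve_D_cX curve_D_cY pderiv_cubic even_in_y_rules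
        by (simp add: curve_normal_form)
      finally show "pderiv cubic * pderiv g + 2 * cubic * pderiv (pderiv g) \<in> Q"
        using half curve.subspace_neg[OF P(1)] by (force simp: Q_def)
    qed (use bf cubic_eq_prod in auto)
    then show ?thesis by (simp add: Q_def)
  qed
  then show ?thesis using curve.subspace_0[OF P(1)] by blast
qed


section \<open>Simplicity of \<open>GCK(A, \<Delta>)\<close>\<close>

theorem theorem2:
  shows
    "subsuperalgebra (ck_scale curve_scale) (ck_mult curve_D)
       (gck_even :: 'f::field_char_0 curve_ring ck set) gck_odd (ck_even UNIV) (ck_odd UNIV) \<and>
     simple_superalgebra (ck_scale curve_scale) (ck_mult curve_D)
       (gck_even :: 'f::field_char_0 curve_ring ck set) gck_odd \<and>
     unital_superalgebra (ck_scale curve_scale) (ck_mult curve_D)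
       (gck_even :: 'f::field_char_0 curve_ring ck set) gck_odd \<and>
     jordan_superalgebra (ck_scale curve_scale) (ck_mult curve_D)
       (gck_even :: 'f::field_char_0 curve_ring ck set) gck_odd"
proof (intro conjI)
  interpret ck: ck_pair curve_D "curve_scale :: 'f \<Rightarrow> _" UNIV UNIV
    by unfold_locales (auto simp: curve_scale_mult curve_D_scale)
  show "subsuperalgebra (ck_scale curve_scale) (ck_mult curve_D)
       (gck_even :: 'f curve_ring ck set) gck_odd (ck_even UNIV) (ck_odd UNIV)"
    unfolding subsuperalgebra_def gck_even_def gck_odd_def
    using gck.superalgebra_ck ck.superalgebra_ck by (auto simp: ck_even_def ck_odd_def)
  show "jordan_superalgebra (ck_scale curve_scale) (ck_mult curve_D)
       (gck_even :: 'f curve_ring ck set) gck_odd"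
    unfolding gck_even_def gck_odd_def
    by (rule gck.jordan_superalgebra_ck)
  show "unital_superalgebra (ck_scale curve_scale) (ck_mult curve_D)
       (gck_even :: 'f curve_ring ck set) gck_odd"
    unfolding gck_even_def gck_odd_def
    by (rule gck.unital_superalgebra_ck) (rule curve_A_generators)
  show "simple_superalgebra (ck_scale curve_scale) (ck_mult curve_D)
       (gck_even :: 'f curve_ring ck set) gck_odd"
    unfolding gck_even_def gck_odd_def
  proof (rule gck.simple_superalgebra_ck)
    have xy: "cX \<in> (curve_M :: 'f curve_ring set)" "cY \<in> (curve_M :: 'f curve_ring set)"
      using curve_A_generators(1) curve.subspace_0[OF curve_A_subspace]
      by (force simp: mem_curve_M)+
    show "1 \<in> (curve_A :: 'f curve_ring set)" by (rule curve_A_generators)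
    show "m = 0" if "\<And>n. n \<in> curve_M \<Longrightarrow> m * n = 0" for m :: "'f curve_ring"
    proof -
      \<comment> \<open>The curve equation says that \<open>x\<close> and \<open>y\<close> generate the unit ideal.\<close>
      have "m = (m * cX) * cX + (m * cY) * cY ^ 3"
        by (simp add: curve_normal_form)
      then show ?thesis using that xy by simp
    qed
    fix P :: "'f curve_ring set"
    assume P: "curve.subspace P" "P \<subseteq> curve_A"
      and ideal: "\<And>a p. a \<in> curve_A \<Longrightarrow> p \<in> P \<Longrightarrow> a * p \<in> P"
      and D: "\<And>p m n. p \<in> P \<Longrightarrow> m \<in> curve_M \<Longrightarrow> n \<in> curve_M \<Longrightarrow> curve_D p * (m * n) \<in> P"
    have "curve_D p \<in> P" if "p \<in> P" for p
    proof -
      have "curve_D p = curve_D p * (cX * cX) + cY ^ 2 * (curve_D p * (cY * cY))"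
        by (simp add: curve_normal_form)
      then show ?thesis
        using D that xy ideal curve_A_generators curve.subspace_add[OF P(1)] by metis
    qed
    then show "P = {0} \<or> 1 \<in> P"
      using P ideal by (intro curve_A_D_simple) auto
  qed
qed

end
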